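(* For every $t \in [0,1]$, let $\mathscr{H}_t$ be the set of (affine) hyperplanes in $\mathbb{R}^n$ which are at distance $t$ away from the origin. For $n \geq 3$ and $t \in (\frac{1}{\sqrt{2}},1]$, we have $$\max_{H \in \mathscr{H}_t} |B_1^n \cap H| = \frac{2^{n-1}(1-t)^{n-1}}{(n-1)!}.$$ The maximum is attained if and only if $H$ is parallel to one of the coordinate hyperplanes $\{x \in \mathbb{R}^n : x_i = 0\}$.
   Context: $B_1^n = \{x \in \mathbb{R}^n : \sum_{i=1}^n |x_i| \leq 1\}$ is the cross-polytope. Distances are Euclidean, and $|B_1^n\cap H|$ denotes the $(n-1)$-dimensional volume (Lebesgue measure on $H$) of $B_1^n \cap H$.
   Formalization: The "only if" part of the equality case is stated for t < 1 only; at t = 1 the maximum is 0 and every hyperplane at distance 1, e.g. with normal (1,1,0,…,0)/√2, attains it, so that direction is false there. *)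

theory Defs
  imports "HOL-Analysis.Analysis"
begin

definition cross_polytope :: "(real ^ 'n) set" where
  "cross_polytope = {x. (\<Sum>i\<in>UNIV. \<bar>x $ i\<bar>) \<le> 1}"

definition hyperplanes_at :: "real \<Rightarrow> 'a::euclidean_space set set" where
  "hyperplanes_at t = {H. (\<exists>a b. a \<noteq> 0 \<and> H = {x. a \<bullet> x = b}) \<and> infdist 0 H = t}"

definition orthonormal_basis_of :: "'a::euclidean_space set \<Rightarrow> 'a set \<Rightarrow> bool" where
  "orthonormal_basis_of V B \<longleftrightarrow>
     pairwise orthogonal B \<and> (\<forall>b\<in>B. norm b = 1) \<and> span B = V"

(* Lebesgue measure on a nonempty affine subspace H, as a Borel measure on the ambient space
   concentrated on H: the image of the product measure under orthonormal coordinates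
   f |-> p + (\<Sum>b\<in>B. f b *\<^sub>R b) of H (compare lborel_eq, where p = 0 and B = Basis).  By
   invariance of Lebesgue measure under isometries, it does not depend on the chosen p and B. *)
definition affine_lborel :: "'a::euclidean_space set \<Rightarrow> 'a measure" where
  "affine_lborel H =
     (let p = (SOME p. p \<in> H);
          B = (SOME B. orthonormal_basis_of ((\<lambda>x. x - p) ` H) B)
      in distr (\<Pi>\<^sub>M b\<in>B. lborel) borel (\<lambda>f. p + (\<Sum>b\<in>B. f b *\<^sub>R b)))"

lemma orthonormal_basis_of_exists:
  fixes H :: "'a::euclidean_space set"
  assumes "affine H" "p \<in> H"
  shows "\<exists>B. orthonormal_basis_of ((\<lambda>x. x - p) ` H) B"
proof -
  have "subspace ((\<lambda>x. x - p) ` H)"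
    using affine_diffs_subspace_subtract[OF assms] by simp
  then show ?thesis
    unfolding orthonormal_basis_of_def by (metis orthonormal_basis_subspace)
qed

(* Volume of the section of A by H, in the dimension of H. *)
definition section_volume :: "'a::euclidean_space set \<Rightarrow> 'a set \<Rightarrow> real" where
  "section_volume A H = measure (affine_lborel H) (A \<inter> H)"

definition parallel_to_coordinate_hyperplane :: "(real ^ 'n) set \<Rightarrow> bool" where
  "parallel_to_coordinate_hyperplane H \<longleftrightarrow> (\<exists>i. affine_parallel H {x. x $ i = 0})"

end

theory Submission
  imports Defs
begin

text \<open>
  The idea is that for \<open>t > 1 / sqrt 2\<close> a hyperplane at distance \<open>t\<close> can only cut off a
  single vertex of the cross-polytope. Let \<open>u\<close> be its unit normal. The functional
  \<open>u \<bullet> x\<close> takes the values \<open>u $ k\<close> and \<open>- u $ k\<close> at the vertices; at most one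
  of the \<open>\<bar>u $ k\<bar>\<close> can reach \<open>t\<close>, because their squares add up to one and
  \<open>2 * t\<^sup>2 > 1\<close>. If none does, the section is empty (\<open>cross_polytope_section_empty\<close>).
  Otherwise put \<open>a = \<bar>u $ k\<bar>\<close> and project the section along the \<open>k\<close>-th axis, which
  multiplies areas by \<open>a\<close> (\<open>emeasure_section_projection\<close>). With
  \<open>r j = u $ j / a\<close>, the projection is described by
  \<open>(\<Sum>j. \<bar>y j\<bar> - r j * y j) \<le> 1 - t / a\<close>, where \<open>j\<close> ranges over the
  \<open>m = n - 1\<close> other indices. Slicing gives the volume
  \<open>(1 - t / a) ^ m / fact m * (\<Prod>j. 2 / (1 - (r j)\<^sup>2))\<close> of this body
  (\<open>emeasure_skew_cross_polytope\<close>).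
  
  The Weierstrass inequality \<open>(\<Prod>j. 1 - (r j)\<^sup>2) \<ge> 1 - (\<Sum>j. (r j)\<^sup>2)\<close>, whose
  right-hand side equals \<open>(2 * a\<^sup>2 - 1) / a\<^sup>2\<close>, eliminates all coordinates of \<open>u\<close>
  except \<open>a\<close>. It remains to see that
  \<open>(1 - t / a) ^ m * (a / (2 * a\<^sup>2 - 1)) < (1 - t) ^ m\<close> for \<open>t \<le> a < 1\<close>
  (\<open>cap_inequality\<close>). So for \<open>t < 1\<close> the maximum is attained exactly if \<open>a = 1\<close>, when the hyperplane
  is parallel to a coordinate hyperplane and the section is a cross-polytope of radius \<open>1 - t\<close>
  (\<open>section_volume_coordinate_hyperplane\<close>).
  
  The ratio between the area of a section and that of its projection comes from computing in two ways
  the volume of the prism over the section whose edges are parallel to the \<open>k\<close>-th axis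
  (\<open>emeasure_oblique_prism\<close> and \<open>emeasure_oblique_prism_projection\<close>). Each is an application
  of Fubini's theorem in an orthonormal basis, one adapted to the hyperplane and the other the standard
  one, and Lebesgue measure is the product measure in either
  (\<open>distr_lborel_orthogonal_transformation\<close>).
\<close>

section \<open>Lebesgue measure in orthonormal coordinates\<close>

lemma orthonormal_basis_of_UNIV:
  fixes C :: "'a::euclidean_space set"
  assumes "orthonormal_basis_of UNIV C"
  shows "finite C" "card C = DIM('a)" "(\<Sum>c\<in>C. (x \<bullet> c) *\<^sub>R c) = x"
proof -
  have orth: "pairwise orthogonal C" and nrm: "\<And>c. c \<in> C \<Longrightarrow> norm c = 1" and sp: "span C = UNIV"
    using assms by (auto simp: orthonormal_basis_of_def)
  have "0 \<notin> C" using nrm by fastforce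
  then have ind: "independent C" using orth by (rule pairwise_orthogonal_independent[rotated])
  then show fin: "finite C" by (rule independent_imp_finite)
  show "card C = DIM('a)"
    using ind sp by (metis dim_UNIV dim_eq_card_independent dim_span)
  show "(\<Sum>c\<in>C. (x \<bullet> c) *\<^sub>R c) = x"
    using orthonormal_basis_expand[OF orth nrm _ fin, of x] sp by (simp add: inner_commute)
qed

lemma inner_orthonormal_sum:
  fixes C :: "'a::euclidean_space set"
  assumes "orthonormal_basis_of V C" "finite C" "c \<in> C"
  shows "(\<Sum>b\<in>C. f b *\<^sub>R b) \<bullet> c = f c"
proof -
  have "(\<Sum>b\<in>C. f b *\<^sub>R b) \<bullet> c = (\<Sum>b\<in>C. if b = c then f b else 0)"
    unfolding inner_sum_left using assms
    by (intro sum.cong) (auto simp: orthonormal_basis_of_def pairwise_def orthogonal_def norm_eq_1)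
  also have "\<dots> = f c" using assms by simp
  finally show ?thesis .
qed

lemma nn_integral_lborel_translation:
  fixes c :: "'a::euclidean_space"
  assumes [measurable]: "g \<in> borel_measurable borel"
  shows "(\<integral>\<^sup>+x. g (c + x) \<partial>lborel) = (\<integral>\<^sup>+x. g x \<partial>lborel)"
proof -
  have "(\<integral>\<^sup>+x. g x \<partial>lborel) = (\<integral>\<^sup>+x. g x \<partial>distr lborel borel ((+) c))"
    by (simp add: lborel_distr_plus)
  also have "\<dots> = (\<integral>\<^sup>+x. g (c + x) \<partial>lborel)" by (subst nn_integral_distr) auto
  finally show ?thesis ..
qed

text \<open>
  Lebesgue measure is, up to a constant, the only translation-invariant measure, and the constant is
  1 because an orthogonal transformation preserves the unit ball. The proof is the uniqueness argument
  specialised to this case: the product of the measure of \<open>f -` A\<close> with the volume of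
  the unit ball is a double integral, in which a translation in each variable and Fubini's theorem
  exchange the roles of the image measure and of Lebesgue measure.
\<close>

lemma distr_lborel_orthogonal_transformation:
  fixes f :: "'a::euclidean_space \<Rightarrow> 'a"
  assumes f: "orthogonal_transformation f"
  shows "distr lborel borel f = lborel"
proof (rule measure_eqI)
  have lin: "linear f" using f by (rule orthogonal_transformation_linear)
  then have [measurable]: "f \<in> borel_measurable borel"
    by (intro borel_measurable_continuous_onI linear_continuous_on) (simp add: linear_conv_bounded_linear)
  have surj: "f (inv f y) = y" for y
    using f by (simp add: orthogonal_transformation_surj surj_f_inv_f)
  let ?v = "emeasure lborel (ball (0 :: 'a) 1)"
  have v: "?v \<noteq> 0" "?v \<noteq> \<infinity>"
    using emeasure_lborel_ball_finite[of "0::'a" 1] open_not_negligible[of "ball (0::'a) 1"]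
    by (auto simp: negligible_iff_null_sets null_sets_def)
  have [measurable]: "ball (0 :: 'a) 1 \<in> sets borel" by simp
  fix A :: "'a set"
  assume "A \<in> sets (distr lborel borel f)"
  then have [measurable]: "A \<in> sets borel" by simp
  have pre: "emeasure (distr lborel borel f) A = (\<integral>\<^sup>+x. indicator A (f x) \<partial>lborel)"
    by (subst nn_integral_indicator[symmetric], simp, subst nn_integral_distr) auto
  have "emeasure (distr lborel borel f) A * ?v =
    (\<integral>\<^sup>+y. (\<integral>\<^sup>+x. indicator A (f x) \<partial>lborel) * indicator (ball (0 :: 'a) 1) y \<partial>lborel)"
    unfolding pre by (simp add: nn_integral_cmult_indicator)
  also have "\<dots> = (\<integral>\<^sup>+y. (\<integral>\<^sup>+x. indicator A (f x + y) * indicator (ball 0 1) y \<partial>lborel) \<partial>lborel)"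
  proof (rule nn_integral_cong)
    fix y
    have "(\<integral>\<^sup>+x. indicator A (f x) \<partial>lborel) = (\<integral>\<^sup>+x. indicator A (f (inv f y + x)) \<partial>lborel)"
      by (subst nn_integral_lborel_translation) auto
    also have "\<dots> = (\<integral>\<^sup>+x. indicator A (f x + y) \<partial>lborel)"
      by (simp add: linear_add[OF lin] surj add.commute)
    finally show "(\<integral>\<^sup>+x. indicator A (f x) \<partial>lborel) * indicator (ball 0 1) y
        = (\<integral>\<^sup>+x. indicator A (f x + y) * indicator (ball 0 1) y \<partial>lborel)"
      by (simp add: nn_integral_multc)
  qed
  also have "\<dots> = (\<integral>\<^sup>+x. (\<integral>\<^sup>+y. indicator A (f x + y) * indicator (ball 0 1) y \<partial>lborel) \<partial>lborel)"
    by (rule lborel_pair.Fubini') measurable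
  also have "\<dots> = (\<integral>\<^sup>+x. (\<integral>\<^sup>+y. indicator A y * indicator (ball 0 1) (y - f x) \<partial>lborel) \<partial>lborel)"
  proof (rule nn_integral_cong)
    fix x
    show "(\<integral>\<^sup>+y. indicator A (f x + y) * indicator (ball 0 1) y \<partial>lborel)
       = (\<integral>\<^sup>+y. indicator A y * indicator (ball 0 1) (y - f x) \<partial>lborel)"
      by (subst nn_integral_lborel_translation[where c="f x", symmetric]) auto
  qed
  also have "\<dots> = (\<integral>\<^sup>+y. (\<integral>\<^sup>+x. indicator A y * indicator (ball 0 1) (y - f x) \<partial>lborel) \<partial>lborel)"
    by (rule lborel_pair.Fubini') measurable
  also have "\<dots> = (\<integral>\<^sup>+y. indicator A y * ?v \<partial>lborel)"
  proof (rule nn_integral_cong)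
    fix y
    have "norm (y - f (inv f y + x)) = norm x" for x
      using f by (simp add: linear_add[OF lin] surj orthogonal_transformation_norm)
    then have "indicator (ball 0 1) (y - f (inv f y + x)) = (indicator (ball 0 1) x :: ennreal)" for x
      by (simp add: indicator_def)
    then have "(\<integral>\<^sup>+x. indicator (ball 0 1) (y - f x) \<partial>lborel) = (\<integral>\<^sup>+x. indicator (ball 0 1) x \<partial>(lborel :: 'a measure))"
      by (subst nn_integral_lborel_translation[where c="inv f y", symmetric]) auto
    then show "(\<integral>\<^sup>+x. indicator A y * indicator (ball 0 1) (y - f x) \<partial>lborel) = indicator A y * ?v"
      by (subst nn_integral_cmult) auto
  qed
  also have "\<dots> = emeasure lborel A * ?v"
    by (simp add: nn_integral_multc)
  finally show "emeasure (distr lborel borel f) A = emeasure lborel A"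
    using v by (simp add: mult.commute[of _ ?v] ennreal_mult_cancel_left)
qed simp

lemma orthogonal_transformation_Basis_onto:
  fixes C :: "'a::euclidean_space set"
  assumes C: "orthonormal_basis_of UNIV C"
  obtains f :: "'a \<Rightarrow> 'a" where "orthogonal_transformation f" "bij_betw f Basis C"
proof -
  have fin: "finite C" and card: "card C = card (Basis :: 'a set)"
    using orthonormal_basis_of_UNIV(1,2)[OF C] by simp_all
  obtain g where g: "bij_betw g (Basis :: 'a set) C"
    using finite_same_card_bij[OF finite_Basis fin card[symmetric]] by auto
  define f where "f x = (\<Sum>b\<in>Basis. (x \<bullet> b) *\<^sub>R g b)" for x :: "'a"
  have fg: "f b = g b" if "b \<in> Basis" for b
  proof -
    have "f b = (\<Sum>b'\<in>Basis. if b' = b then g b' else 0)"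
      unfolding f_def using that by (intro sum.cong) (auto simp: inner_Basis)
    then show ?thesis using that by simp
  qed
  have lin: "linear f"
    unfolding f_def by (intro linear_compose_sum ballI linearI) (auto simp: inner_add_left scaleR_left_distrib)
  have gg: "g b \<bullet> g b' = (if b = b' then 1 else 0)" if "b \<in> Basis" "b' \<in> Basis" for b b'
  proof -
    have "g b \<in> C" "g b' \<in> C" "g b = g b' \<longleftrightarrow> b = b'"
      using that g by (auto simp: bij_betw_def inj_on_eq_iff)
    then show ?thesis
      using C unfolding orthonormal_basis_of_def pairwise_def orthogonal_def norm_eq_1 by metis
  qed
  have "f v \<bullet> f w = v \<bullet> w" for v w
  proof -
    have "f v \<bullet> f w = (\<Sum>b\<in>Basis. \<Sum>b'\<in>Basis. (v \<bullet> b) * ((w \<bullet> b') * (g b \<bullet> g b')))"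
      unfolding f_def inner_sum_left inner_sum_right
      by (subst sum.swap) (simp add: mult.left_commute)
    also have "\<dots> = (\<Sum>b\<in>Basis. \<Sum>b'\<in>Basis. if b' = b then (v \<bullet> b) * (w \<bullet> b') else 0)"
      by (intro sum.cong) (auto simp: gg)
    also have "\<dots> = v \<bullet> w" by (simp add: euclidean_inner[of v w])
    finally show ?thesis .
  qed
  then have "orthogonal_transformation f" using lin by (simp add: orthogonal_transformation_def)
  moreover have "bij_betw f Basis C" using g fg by (simp cong: bij_betw_cong)
  ultimately show ?thesis by (rule that)
qed

text \<open>
  The standard basis is carried onto \<open>C\<close> by an orthogonal transformation, which preserves
  Lebesgue measure. Hence a box in the coordinates of \<open>C\<close> has the same measure as the box with
  the same sides in the standard coordinates, and boxes determine the product measure.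
\<close>

lemma PiM_lborel_eq_distr_coordinates:
  fixes C :: "'a::euclidean_space set"
  assumes C: "orthonormal_basis_of UNIV C"
  shows "distr lborel (\<Pi>\<^sub>M c\<in>C. lborel) (\<lambda>x. \<lambda>c\<in>C. x \<bullet> c) = (\<Pi>\<^sub>M c\<in>C. (lborel :: real measure))"
proof -
  interpret product_sigma_finite "\<lambda>_. lborel :: real measure" by standard
  have fin: "finite C" using orthonormal_basis_of_UNIV[OF C] by simp
  obtain f :: "'a \<Rightarrow> 'a" where f: "orthogonal_transformation f" and bij: "bij_betw f Basis C"
    using orthogonal_transformation_Basis_onto[OF C] .
  have [measurable]: "f \<in> borel_measurable borel"
    using orthogonal_transformation_linear[OF f]
    by (intro borel_measurable_continuous_onI linear_continuous_on) (simp add: linear_conv_bounded_linear)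
  show ?thesis
  proof (rule PiM_eqI[OF fin])
    fix A :: "'a \<Rightarrow> real set"
    assume A: "\<And>i. i \<in> C \<Longrightarrow> A i \<in> sets lborel"
    have fB: "f b \<in> C" if "b \<in> Basis" for b using bij that by (auto simp: bij_betw_def)
    have [measurable]: "A (f b) \<in> sets borel" if "b \<in> Basis" for b using A[OF fB[OF that]] by simp
    have AC [measurable]: "c \<in> C \<Longrightarrow> A c \<in> sets borel" for c using A by simp
    have set1: "{x. \<forall>c\<in>C. x \<bullet> c \<in> A c} \<in> sets borel"
    proof -
      have "{x::'a. \<forall>c\<in>C. x \<bullet> c \<in> A c} = {x \<in> space borel. \<forall>c\<in>C. x \<bullet> c \<in> A c}" by simp
      also have "\<dots> \<in> sets borel" using fin by measurable
      finally show ?thesis .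
    qed
    have "emeasure (distr lborel (\<Pi>\<^sub>M c\<in>C. lborel) (\<lambda>x. \<lambda>c\<in>C. x \<bullet> c)) (Pi\<^sub>E C A)
        = emeasure lborel {x. \<forall>c\<in>C. x \<bullet> c \<in> A c}"
      using A fin by (subst emeasure_distr) (auto intro!: arg_cong2[where f=emeasure] sets_PiM_I_finite)
    also have "\<dots> = emeasure (distr lborel borel f) {x. \<forall>c\<in>C. x \<bullet> c \<in> A c}"
      by (simp add: distr_lborel_orthogonal_transformation[OF f])
    also have "\<dots> = emeasure lborel {x. \<forall>b\<in>Basis. x \<bullet> b \<in> A (f b)}"
    proof (subst emeasure_distr)
      have "f -` {x. \<forall>c\<in>C. x \<bullet> c \<in> A c} = {x. \<forall>b\<in>Basis. f x \<bullet> f b \<in> A (f b)}"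
        using bij by (auto simp: bij_betw_def)
      also have "\<dots> = {x. \<forall>b\<in>Basis. x \<bullet> b \<in> A (f b)}"
        using f by (simp add: orthogonal_transformation_def)
      finally show "emeasure lborel (f -` {x. \<forall>c\<in>C. x \<bullet> c \<in> A c} \<inter> space lborel)
          = emeasure lborel {x. \<forall>b\<in>Basis. x \<bullet> b \<in> A (f b)}" by simp
    qed (use set1 in auto)
    also have "\<dots> = emeasure (\<Pi>\<^sub>M b\<in>Basis. lborel) (\<Pi>\<^sub>E b\<in>Basis. A (f b))"
    proof -
      have "{x::'a. \<forall>b\<in>Basis. x \<bullet> b \<in> A (f b)} = {x \<in> space borel. \<forall>b\<in>Basis. x \<bullet> b \<in> A (f b)}" by simp
      also have "\<dots> \<in> sets borel" by measurable
      finally have "emeasure lborel {x. \<forall>b\<in>Basis. x \<bullet> b \<in> A (f b)} =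
         emeasure (\<Pi>\<^sub>M b\<in>Basis. lborel)
          ((\<lambda>h. \<Sum>b\<in>Basis. h b *\<^sub>R b) -` {x. \<forall>b\<in>Basis. x \<bullet> b \<in> A (f b)} \<inter> space (\<Pi>\<^sub>M b\<in>Basis. lborel))"
        by (subst lborel_eq, subst emeasure_distr) auto
      also have "((\<lambda>h. \<Sum>b\<in>Basis. h b *\<^sub>R b) -` {x. \<forall>b\<in>Basis. x \<bullet> b \<in> A (f b)} \<inter> space (\<Pi>\<^sub>M b\<in>Basis. lborel))
         = (\<Pi>\<^sub>E b\<in>Basis. A (f b))"
        by (auto simp: space_PiM PiE_def Pi_def)
      finally show ?thesis .
    qed
    also have "\<dots> = (\<Prod>b\<in>Basis. emeasure lborel (A (f b)))"
      by (rule emeasure_PiM) auto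
    also have "\<dots> = (\<Prod>c\<in>C. emeasure lborel (A c))"
      using bij by (rule prod.reindex_bij_betw)
    finally show "emeasure (distr lborel (\<Pi>\<^sub>M c\<in>C. lborel) (\<lambda>x. \<lambda>c\<in>C. x \<bullet> c)) (Pi\<^sub>E C A)
       = (\<Prod>c\<in>C. emeasure lborel (A c))" .
  qed simp
qed

lemma emeasure_lborel_orthonormal_coordinates:
  fixes C :: "'a::euclidean_space set"
  assumes C: "orthonormal_basis_of UNIV C" and A: "A \<in> sets borel"
  shows "emeasure lborel A =
    (\<integral>\<^sup>+f. indicator A (p + (\<Sum>c\<in>C. f c *\<^sub>R c)) \<partial>(\<Pi>\<^sub>M c\<in>C. lborel))"
proof -
  have fin: "finite C" using orthonormal_basis_of_UNIV[OF C] by simp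
  note [measurable] = A
  have "(\<integral>\<^sup>+f. indicator A (p + (\<Sum>c\<in>C. f c *\<^sub>R c)) \<partial>(\<Pi>\<^sub>M c\<in>C. lborel))
     = (\<integral>\<^sup>+f. indicator A (p + (\<Sum>c\<in>C. f c *\<^sub>R c))
         \<partial>(distr lborel (\<Pi>\<^sub>M c\<in>C. lborel) (\<lambda>x. \<lambda>c\<in>C. x \<bullet> c)))"
    by (simp add: PiM_lborel_eq_distr_coordinates[OF C])
  also have "\<dots> = (\<integral>\<^sup>+x. indicator A (p + x) \<partial>lborel)"
    using fin by (subst nn_integral_distr) (auto simp: orthonormal_basis_of_UNIV[OF C])
  also have "\<dots> = (\<integral>\<^sup>+x. indicator A x \<partial>distr lborel borel ((+) p))"
    by (subst nn_integral_distr) auto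
  also have "\<dots> = emeasure lborel A" by (simp add: lborel_distr_plus)
  finally show ?thesis ..
qed

text \<open>
  Fubini's theorem in an orthonormal basis in which one vector \<open>v\<close> is singled out. The slices
  orthogonal to \<open>v\<close> give areas in hyperplanes; the slices parallel to \<open>v\<close> give
  projections along \<open>v\<close>.
\<close>

lemma emeasure_lborel_slices:
  fixes v :: "'a::euclidean_space"
  assumes C: "orthonormal_basis_of UNIV (insert v B)" and v: "v \<notin> B" and A: "A \<in> sets borel"
  shows "emeasure lborel A = (\<integral>\<^sup>+s. (\<integral>\<^sup>+f. indicator A (p + (s *\<^sub>R v + (\<Sum>b\<in>B. f b *\<^sub>R b)))
            \<partial>(\<Pi>\<^sub>M b\<in>B. lborel)) \<partial>lborel)"
    and "emeasure lborel A = (\<integral>\<^sup>+f. (\<integral>\<^sup>+s. indicator A (p + (s *\<^sub>R v + (\<Sum>b\<in>B. f b *\<^sub>R b)))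
            \<partial>lborel) \<partial>(\<Pi>\<^sub>M b\<in>B. lborel))"
proof -
  interpret product_sigma_finite "\<lambda>_. lborel :: real measure" by standard
  have fin: "finite B" using orthonormal_basis_of_UNIV[OF C] by simp
  note [measurable] = A
  have up: "(\<Sum>b\<in>B. (f(v := s)) b *\<^sub>R b) = (\<Sum>b\<in>B. f b *\<^sub>R b)" for f :: "'a \<Rightarrow> real" and s
    using v by (intro sum.cong) auto
  note * = emeasure_lborel_orthonormal_coordinates[OF C A, of p]
  show "emeasure lborel A = (\<integral>\<^sup>+s. (\<integral>\<^sup>+f. indicator A (p + (s *\<^sub>R v + (\<Sum>b\<in>B. f b *\<^sub>R b)))
            \<partial>(\<Pi>\<^sub>M b\<in>B. lborel)) \<partial>lborel)"
    unfolding * using fin v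
    by (subst product_nn_integral_insert_rev) (auto simp: up simp del: fun_upd_apply, simp)
  show "emeasure lborel A = (\<integral>\<^sup>+f. (\<integral>\<^sup>+s. indicator A (p + (s *\<^sub>R v + (\<Sum>b\<in>B. f b *\<^sub>R b)))
            \<partial>lborel) \<partial>(\<Pi>\<^sub>M b\<in>B. lborel))"
    unfolding * using fin v
    by (subst product_nn_integral_insert) (auto simp: up simp del: fun_upd_apply, simp)
qed

lemma distr_PiM_lborel_translation:
  assumes fin: "finite B"
  shows "distr (\<Pi>\<^sub>M b\<in>B. lborel) (\<Pi>\<^sub>M b\<in>B. lborel) (\<lambda>f. \<lambda>b\<in>B. d b + f b)
      = (\<Pi>\<^sub>M b\<in>B. (lborel :: real measure))"
proof -
  interpret product_sigma_finite "\<lambda>_. lborel :: real measure" by standard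
  show ?thesis
  proof (rule PiM_eqI[OF fin])
    fix A assume A: "\<And>i. i \<in> B \<Longrightarrow> A i \<in> sets (lborel :: real measure)"
    have vim: "(+) (d b) -` A b \<in> sets borel" if "b \<in> B" for b
      using A[OF that] by (intro measurable_sets_borel[of "(+) (d b)" borel]) auto
    have "emeasure (distr (\<Pi>\<^sub>M b\<in>B. lborel) (\<Pi>\<^sub>M b\<in>B. lborel) (\<lambda>f. \<lambda>b\<in>B. d b + f b)) (Pi\<^sub>E B A)
       = emeasure (\<Pi>\<^sub>M b\<in>B. lborel) (\<Pi>\<^sub>E b\<in>B. (+) (d b) -` A b)"
      using A fin by (subst emeasure_distr)
        (auto intro!: arg_cong2[where f=emeasure] sets_PiM_I_finite,
          auto simp: space_PiM PiE_def Pi_def extensional_def)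
    also have "\<dots> = (\<Prod>b\<in>B. emeasure lborel ((+) (d b) -` A b))"
      using fin vim by (intro emeasure_PiM) auto
    also have "\<dots> = (\<Prod>b\<in>B. emeasure (distr lborel borel ((+) (d b))) (A b))"
      using A by (intro prod.cong refl, subst emeasure_distr) auto
    also have "\<dots> = (\<Prod>b\<in>B. emeasure lborel (A b))" by (simp add: lborel_distr_plus)
    finally show "emeasure (distr (\<Pi>\<^sub>M b\<in>B. lborel) (\<Pi>\<^sub>M b\<in>B. lborel) (\<lambda>f. \<lambda>b\<in>B. d b + f b)) (Pi\<^sub>E B A)
       = (\<Prod>b\<in>B. emeasure lborel (A b))" .
  qed simp
qed

section \<open>The volume of a skew cross-polytope\<close>

lemma weierstrass_product_inequality:
  fixes f :: "'a \<Rightarrow> real"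
  assumes "finite A" "\<And>a. a \<in> A \<Longrightarrow> 0 \<le> f a" "\<And>a. a \<in> A \<Longrightarrow> f a \<le> 1"
  shows "1 - sum f A \<le> (\<Prod>a\<in>A. 1 - f a)"
  using assms
proof (induction A rule: finite_induct)
  case (insert x A)
  have "(\<Prod>a\<in>A. 1 - f a) \<le> 1" using insert.prems by (intro prod_le_1) auto
  then have "f x * (\<Prod>a\<in>A. 1 - f a) \<le> f x * 1"
    using insert.prems by (intro mult_left_mono) auto
  then show ?case using insert by (simp add: algebra_simps)
qed simp

text \<open>
  The induction step for the volume of \<open>{f. \<Sum>c. \<bar>f c\<bar> - r c * f c \<le> w}\<close>. The function
  \<open>\<bar>y\<bar> - r * y\<close> has slope \<open>1 - r\<close> to the right of the origin and
  \<open>1 + r\<close> to the left of it, so each half-line contributes the integral of a power of a linear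
  function, and \<open>1 / (1 - r) + 1 / (1 + r) = 2 / (1 - r\<^sup>2)\<close>.
\<close>

lemma one_dim_cap_integral:
  fixes r w :: real
  assumes r: "\<bar>r\<bar> < 1" and w: "0 \<le> w"
  shows "(\<integral>\<^sup>+y. ennreal ((w - (\<bar>y\<bar> - r * y)) ^ m) * indicator {y. \<bar>y\<bar> - r * y \<le> w} y \<partial>lborel)
       = ennreal (w ^ Suc m / Suc m * (2 / (1 - r\<^sup>2)))"
proof -
  have half: "(\<integral>\<^sup>+y. ennreal ((w - a * y) ^ m) * indicator {0..w / a} y \<partial>lborel)
       = ennreal (w ^ Suc m / Suc m / a)" if a: "a > 0" for a
  proof -
    have "(\<integral>\<^sup>+y. ennreal ((w - a * y) ^ m) * indicator {0..w / a} y \<partial>lborel)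
       = ennreal (- ((w - a * (w / a)) ^ Suc m / Suc m / a) - (- ((w - a * 0) ^ Suc m / Suc m / a)))"
    proof (rule nn_integral_FTC_Icc)
      fix y assume y: "y \<in> {0..w / a}"
      show "((\<lambda>y. - ((w - a * y) ^ Suc m / Suc m / a)) has_real_derivative (w - a * y) ^ m) (at y)"
        using a by (auto intro!: derivative_eq_intros simp del: power_Suc of_nat_Suc)
      show "0 \<le> (w - a * y) ^ m" using y a by (simp add: field_simps)
    qed (use a w in auto)
    then show ?thesis using a by simp
  qed
  have ab: "0 < 1 - r" "0 < 1 + r" using r by auto
  let ?h = "\<lambda>y. ennreal ((w - (1 + r) * y) ^ m) * indicator {0..w / (1 + r)} y"
  have "(\<integral>\<^sup>+y. ennreal ((w - (\<bar>y\<bar> - r * y)) ^ m) * indicator {y. \<bar>y\<bar> - r * y \<le> w} y \<partial>lborel)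
     = (\<integral>\<^sup>+y. ennreal ((w - (1 - r) * y) ^ m) * indicator {0..w / (1 - r)} y
            + ?h (- y) \<partial>lborel)"
  \<comment> \<open>The two half-lines overlap at the origin, hence an equality almost everywhere.\<close>
  proof (intro nn_integral_cong_AE, use AE_lborel_singleton[of 0] in eventually_elim)
    fix y :: real assume "y \<noteq> 0"
    then show "ennreal ((w - (\<bar>y\<bar> - r * y)) ^ m) * indicator {y. \<bar>y\<bar> - r * y \<le> w} y =
      ennreal ((w - (1 - r) * y) ^ m) * indicator {0..w / (1 - r)} y + ?h (- y)"
      using ab by (cases "y > 0") (auto simp: indicator_def field_simps)
  qed
  also have "\<dots> = (\<integral>\<^sup>+y. ennreal ((w - (1 - r) * y) ^ m) * indicator {0..w / (1 - r)} y \<partial>lborel)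
            + (\<integral>\<^sup>+y. ?h (- y) \<partial>lborel)"
    by (rule nn_integral_add) auto
  also have "(\<integral>\<^sup>+y. ?h (- y) \<partial>lborel) = (\<integral>\<^sup>+y. ?h y \<partial>distr lborel borel uminus)"
    by (subst nn_integral_distr) auto
  also have "\<dots> = ennreal (w ^ Suc m / Suc m / (1 + r))"
    unfolding lborel_distr_uminus by (rule half) (use ab in simp)
  also have "(\<integral>\<^sup>+y. ennreal ((w - (1 - r) * y) ^ m) * indicator {0..w / (1 - r)} y \<partial>lborel)
     = ennreal (w ^ Suc m / Suc m / (1 - r))"
    by (rule half) (use ab in simp)
  also have "\<dots> + ennreal (w ^ Suc m / Suc m / (1 + r))
     = ennreal (w ^ Suc m / Suc m / (1 - r) + w ^ Suc m / Suc m / (1 + r))"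
    using ab w by (subst ennreal_plus) auto
  also have "w ^ Suc m / Suc m / (1 - r) + w ^ Suc m / Suc m / (1 + r)
     = w ^ Suc m / Suc m * (1 / (1 - r) + 1 / (1 + r))"
    by (simp add: distrib_left)
  also have "1 / (1 - r) + 1 / (1 + r) = 2 / (1 - r\<^sup>2)"
    using ab by (simp add: field_simps power2_eq_square)
  finally show ?thesis .
qed

text \<open>
  This body encloses the projection of a section of the cross-polytope along an axis. Its slice at
  height \<open>y\<close> in one coordinate is a body of the same kind in the other coordinates, with
  \<open>w\<close> diminished by \<open>\<bar>y\<bar> - r i * y\<close>, which makes an induction on the dimension possible.
\<close>

lemma emeasure_skew_cross_polytope:
  fixes r :: "'a \<Rightarrow> real"
  assumes "finite J" "\<And>c. c \<in> J \<Longrightarrow> \<bar>r c\<bar> < 1" "0 \<le> w"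
  shows "emeasure (\<Pi>\<^sub>M c\<in>J. lborel)
      {f \<in> space (\<Pi>\<^sub>M c\<in>J. lborel). (\<Sum>c\<in>J. \<bar>f c\<bar> - r c * f c) \<le> w}
    = ennreal (w ^ card J / fact (card J) * (\<Prod>c\<in>J. 2 / (1 - (r c)\<^sup>2)))"
  using assms
proof (induction J arbitrary: w rule: finite_induct)
  case empty
  then show ?case by (simp add: PiM_empty)
next
  case (insert i J)
  interpret product_sigma_finite "\<lambda>_. lborel :: real measure" by standard
  let ?M = "\<lambda>J. \<Pi>\<^sub>M c\<in>J. (lborel :: real measure)"
  let ?g = "\<lambda>J f. \<Sum>c\<in>J. \<bar>f c\<bar> - r c * f c"
  define P where "P = (\<Prod>c\<in>J. 2 / (1 - (r c)\<^sup>2))"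
  have sq: "(r c)\<^sup>2 < 1" if "c \<in> insert i J" for c
    using insert.prems(1)[OF that] by (simp add: abs_square_less_1)
  have P: "0 \<le> P" unfolding P_def
    by (intro prod_nonneg divide_nonneg_nonneg) (use sq in \<open>auto intro: less_imp_le\<close>)
  have nonneg: "0 \<le> ?g J f" for f
  proof (intro sum_nonneg)
    fix c assume "c \<in> J"
    then have "\<bar>r c\<bar> < 1" using insert.prems by auto
    then have "\<bar>r c * f c\<bar> \<le> 1 * \<bar>f c\<bar>" unfolding abs_mult by (intro mult_right_mono) auto
    then show "0 \<le> \<bar>f c\<bar> - r c * f c" by linarith
  qed
  have meas [measurable]: "{f \<in> space (?M J). ?g J f \<le> w} \<in> sets (?M J)" if "finite J" for J w
    using that by measurable
  have IH: "emeasure (?M J) {f \<in> space (?M J). ?g J f \<le> w'}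
      = ennreal (w' ^ card J / fact (card J) * P) * indicator {0..} w'" for w'
  proof (cases "0 \<le> w'")
    case True
    then show ?thesis using insert.IH[of w'] insert.prems by (simp add: P_def)
  next
    case False
    then have "{f \<in> space (?M J). ?g J f \<le> w'} = {}" using nonneg
      by (force simp: not_le intro: less_le_trans)
    then show ?thesis using False by (simp only: emeasure_empty) simp
  qed
  have "emeasure (?M (insert i J)) {f \<in> space (?M (insert i J)). ?g (insert i J) f \<le> w}
     = (\<integral>\<^sup>+f. indicator {f \<in> space (?M (insert i J)). ?g (insert i J) f \<le> w} f \<partial>?M (insert i J))"
    using insert.hyps by (subst nn_integral_indicator) auto
  also have "\<dots> = (\<integral>\<^sup>+y. \<integral>\<^sup>+f. indicator {f \<in> space (?M (insert i J)). ?g (insert i J) f \<le> w} (f(i := y))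
        \<partial>?M J \<partial>lborel)"
    using insert.hyps by (subst product_nn_integral_insert_rev) auto
  also have "\<dots> = (\<integral>\<^sup>+y. \<integral>\<^sup>+f. indicator {f \<in> space (?M J). ?g J f \<le> w - (\<bar>y\<bar> - r i * y)} f
        \<partial>?M J \<partial>lborel)"
  proof (intro nn_integral_cong)
    fix y f assume f: "f \<in> space (?M J)"
    then have "f(i := y) \<in> space (?M (insert i J))" by (auto simp: space_PiM PiE_def extensional_def split: if_splits)
    moreover have "?g (insert i J) (f(i := y)) = (\<bar>y\<bar> - r i * y) + ?g J f"
    proof -
      have "?g J (f(i := y)) = ?g J f" using insert.hyps by (intro sum.cong) auto
      then show ?thesis using insert.hyps by simp
    qed
    ultimately show "indicator {f \<in> space (?M (insert i J)). ?g (insert i J) f \<le> w} (f(i := y))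
       = indicator {f \<in> space (?M J). ?g J f \<le> w - (\<bar>y\<bar> - r i * y)} f"
      using f by (auto simp: indicator_def simp del: fun_upd_apply)
  qed
  also have "\<dots> = (\<integral>\<^sup>+y. emeasure (?M J) {f \<in> space (?M J). ?g J f \<le> w - (\<bar>y\<bar> - r i * y)} \<partial>lborel)"
    using insert.hyps by (subst nn_integral_indicator) auto
  also have "\<dots> = (\<integral>\<^sup>+y. ennreal (P / fact (card J)) *
      (ennreal ((w - (\<bar>y\<bar> - r i * y)) ^ card J) * indicator {y. \<bar>y\<bar> - r i * y \<le> w} y) \<partial>lborel)"
  proof (intro nn_integral_cong)
    fix y :: real
    show "emeasure (?M J) {f \<in> space (?M J). ?g J f \<le> w - (\<bar>y\<bar> - r i * y)} =
     ennreal (P / fact (card J)) *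
      (ennreal ((w - (\<bar>y\<bar> - r i * y)) ^ card J) * indicator {y. \<bar>y\<bar> - r i * y \<le> w} y)"
    proof (cases "\<bar>y\<bar> - r i * y \<le> w")
      case True
      then show ?thesis unfolding IH using P by (simp add: ennreal_mult'[symmetric] mult.commute)
    qed (simp add: IH)
  qed
  also have "\<dots> = ennreal (P / fact (card J)) *
      ennreal (w ^ Suc (card J) / Suc (card J) * (2 / (1 - (r i)\<^sup>2)))"
    using insert.prems
    by (subst nn_integral_cmult) (auto simp: one_dim_cap_integral)
  also have "\<dots> = ennreal (P / fact (card J) * (w ^ Suc (card J) / Suc (card J) * (2 / (1 - (r i)\<^sup>2))))"
    using P by (subst ennreal_mult') auto
  also have "P / fact (card J) * (w ^ Suc (card J) / Suc (card J) * (2 / (1 - (r i)\<^sup>2)))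
     = w ^ card (insert i J) / fact (card (insert i J)) * (\<Prod>c\<in>insert i J. 2 / (1 - (r c)\<^sup>2))"
    using insert.hyps by (simp add: P_def mult_ac)
  finally show ?case .
qed

section \<open>The one-variable inequality\<close>

lemma gt_inverse_sqrt_2:
  fixes x :: real
  assumes "1 / sqrt 2 < x"
  shows "0 < x" "0 < 2 * x\<^sup>2 - 1"
proof -
  show "0 < x" using assms
    by (meson divide_pos_pos less_trans real_sqrt_gt_0_iff zero_less_one zero_less_numeral)
  have "(1 / sqrt 2)\<^sup>2 < x\<^sup>2" using assms by (intro power_strict_mono) auto
  then show "0 < 2 * x\<^sup>2 - 1" by (simp add: power_divide)
qed

text \<open>
  The case of dimension three. Both sides agree at \<open>a = 1\<close>, so their difference is
  \<open>1 - a\<close> times a polynomial \<open>k a\<close>, which is quadratic and concave in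
  \<open>a\<close>. It suffices that \<open>k\<close> is positive at the ends of the interval from
  \<open>t\<close> to \<open>1\<close>. The value at \<open>t\<close> has the sign of
  \<open>2 * t\<^sup>2 - 1\<close>, which is where the threshold \<open>1 / sqrt 2\<close> comes from.
\<close>

lemma cap_inequality_cubic:
  fixes a t :: real
  assumes t: "1 / sqrt 2 < t" and a: "t \<le> a" "a < 1"
  shows "(a - t)\<^sup>2 < (1 - t)\<^sup>2 * (a * (2 * a\<^sup>2 - 1))"
proof -
  have t0: "0 < t" and t2: "0 < 2 * t\<^sup>2 - 1" using gt_inverse_sqrt_2[OF t] by auto
  have t35: "5 * t > 3"
  proof (rule ccontr)
    assume "\<not> ?thesis"
    then have "t * t \<le> (3/5) * (3/5)" using t0 by (intro mult_mono) auto
    with t2 show False by (simp add: power2_eq_square)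
  qed
  have t1: "t < 1" using a by simp
  define k where "k = (\<lambda>x. 1 + x - 2 * t - (1 - t)\<^sup>2 * (2 * x\<^sup>2 + 2 * x + 1))"
  have k1: "0 < k 1"
  proof -
    have "k 1 = (1 - t) * (5 * t - 3)" by (simp add: k_def power2_eq_square algebra_simps)
    then show ?thesis using t1 t35 by simp
  qed
  have kt: "0 < k t"
  proof -
    have "k t = (1 - t) * (t * (2 * t\<^sup>2 - 1))" by (simp add: k_def power2_eq_square algebra_simps)
    then show ?thesis using t1 t0 t2 by simp
  qed
  have ka: "0 < k a"
  proof -
    \<comment> \<open>Linear interpolation of k between t and 1; the last term is the excess due to concavity.\<close>
    have id: "(1 - t) * k a = (1 - a) * k t + (a - t) * k 1 + 2 * (1 - t) ^ 3 * (1 - a) * (a - t)"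
      by (simp add: k_def power2_eq_square power3_eq_cube algebra_simps)
    have "0 < (1 - a) * k t" using a kt by simp
    moreover have "0 \<le> (a - t) * k 1" using a k1 by simp
    moreover have "0 \<le> 2 * (1 - t) ^ 3 * (1 - a) * (a - t)" using a t1 by simp
    ultimately have "0 < (1 - t) * k a" unfolding id by linarith
    then show ?thesis using t1 by (simp add: zero_less_mult_iff)
  qed
  have "(1 - t)\<^sup>2 * (a * (2 * a\<^sup>2 - 1)) - (a - t)\<^sup>2 = (1 - a) * k a"
    by (simp add: k_def power2_eq_square algebra_simps)
  moreover have "0 < (1 - a) * k a" using a ka by simp
  ultimately show ?thesis by linarith
qed

text \<open>
  Every dimension beyond three multiplies the left-hand side by \<open>1 - t / a\<close> and the right-hand
  side by the larger \<open>1 - t\<close>, so the case \<open>m = 2\<close> is decisive. For \<open>m = 1\<close> the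
  inequality fails when \<open>t < 3 / 4\<close> and \<open>a\<close> is close to \<open>1\<close>.
\<close>

lemma cap_inequality:
  fixes a t :: real
  assumes t: "1 / sqrt 2 < t" and a: "t \<le> a" "a < 1" and m: "2 \<le> m"
  shows "(1 - t / a) ^ m * (a / (2 * a\<^sup>2 - 1)) < (1 - t) ^ m"
proof -
  have t0: "0 < t" using gt_inverse_sqrt_2[OF t] by simp
  have a2: "0 < 2 * a\<^sup>2 - 1" using t a by (intro gt_inverse_sqrt_2) simp
  have a0: "0 < a" using t0 a by simp
  have le: "0 \<le> 1 - t / a" "1 - t / a \<le> 1 - t"
    using a t0 a0 by (auto simp: field_simps mult_left_le)
  have "(1 - t / a)\<^sup>2 * (a / (2 * a\<^sup>2 - 1)) = (a - t)\<^sup>2 / (a * (2 * a\<^sup>2 - 1))"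
    using a0 a2 by (simp add: field_simps power2_eq_square)
  also have "\<dots> < (1 - t)\<^sup>2"
    using cap_inequality_cubic[OF t a] a0 a2 by (simp add: divide_less_eq)
  finally have two: "(1 - t / a)\<^sup>2 * (a / (2 * a\<^sup>2 - 1)) < (1 - t)\<^sup>2" .
  obtain j where j: "m = j + 2" using m by (metis add.commute le_Suc_ex)
  have "(1 - t / a) ^ m * (a / (2 * a\<^sup>2 - 1)) = (1 - t / a) ^ j * ((1 - t / a)\<^sup>2 * (a / (2 * a\<^sup>2 - 1)))"
    by (simp only: j power_add mult.assoc)
  also have "\<dots> \<le> (1 - t) ^ j * ((1 - t / a)\<^sup>2 * (a / (2 * a\<^sup>2 - 1)))"
    using le a0 a2 by (intro mult_right_mono power_mono) auto
  also have "\<dots> < (1 - t) ^ j * (1 - t)\<^sup>2"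
    using two a by (intro mult_strict_left_mono) auto
  finally show ?thesis by (simp only: j power_add)
qed

section \<open>Hyperplanes and oblique prisms\<close>

lemma infdist_hyperplane:
  fixes a :: "'a::euclidean_space"
  assumes a: "a \<noteq> 0"
  shows "infdist 0 {x. a \<bullet> x = b} = \<bar>b\<bar> / norm a"
proof (rule antisym)
  let ?y = "(b / (norm a)\<^sup>2) *\<^sub>R a"
  have "?y \<in> {x. a \<bullet> x = b}" using a by (simp add: power2_norm_eq_inner)
  moreover have "dist 0 ?y = \<bar>b\<bar> / norm a" using a by (simp add: power2_eq_square)
  ultimately show "infdist 0 {x. a \<bullet> x = b} \<le> \<bar>b\<bar> / norm a" by (metis infdist_le)
  show "\<bar>b\<bar> / norm a \<le> infdist 0 {x. a \<bullet> x = b}"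
  proof -
    have ne: "{x. a \<bullet> x = b} \<noteq> {}" using \<open>?y \<in> _\<close> by blast
    have "\<bar>b\<bar> / norm a \<le> dist 0 x" if "a \<bullet> x = b" for x
      using Cauchy_Schwarz_ineq2[of a x] that a by (simp add: divide_le_eq mult.commute)
    then show ?thesis unfolding infdist_notempty[OF ne] using ne by (intro cINF_greatest) auto
  qed
qed

lemma hyperplanes_at_iff:
  fixes H :: "'a::euclidean_space set"
  assumes t: "0 < t"
  shows "H \<in> hyperplanes_at t \<longleftrightarrow> (\<exists>u. norm u = 1 \<and> H = {x. u \<bullet> x = t})"
proof
  assume "H \<in> hyperplanes_at t"
  then obtain a b where a: "a \<noteq> 0" and H: "H = {x. a \<bullet> x = b}" and d: "infdist 0 H = t"
    by (auto simp: hyperplanes_at_def)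
  have tb: "t = \<bar>b\<bar> / norm a" using d infdist_hyperplane[OF a, of b] H by simp
  then have b: "b \<noteq> 0" using t by auto
  let ?u = "(sgn b / norm a) *\<^sub>R a"
  have "norm ?u = 1" using a b by (simp add: abs_sgn_eq)
  moreover have "H = {x. ?u \<bullet> x = t}"
    unfolding H tb using a b by (auto simp: field_simps abs_sgn sgn_if split: if_splits)
  ultimately show "\<exists>u. norm u = 1 \<and> H = {x. u \<bullet> x = t}" by blast
next
  assume "\<exists>u. norm u = 1 \<and> H = {x. u \<bullet> x = t}"
  then obtain u where "norm u = 1" "H = {x. u \<bullet> x = t}" by blast
  moreover have "u \<noteq> 0" using \<open>norm u = 1\<close> by auto
  ultimately show "H \<in> hyperplanes_at t"
    using infdist_hyperplane[of u t] t unfolding hyperplanes_at_def by auto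
qed

lemma orthonormal_basis_insert_normal:
  fixes u :: "'a::euclidean_space"
  assumes u: "norm u = 1" and B: "orthonormal_basis_of {d. u \<bullet> d = 0} B"
  shows "orthonormal_basis_of UNIV (insert u B)" "u \<notin> B"
proof -
  have sp: "span B = {d. u \<bullet> d = 0}" using B by (simp add: orthonormal_basis_of_def)
  have uB: "u \<bullet> b = 0" if "b \<in> B" for b
    using span_base[OF that] unfolding sp by simp
  have uu: "u \<bullet> u = 1" using u by (simp add: norm_eq_1)
  show "u \<notin> B" using uB uu by auto
  have "x \<in> span (insert u B)" for x
  proof -
    have "x - (u \<bullet> x) *\<^sub>R u \<in> span B" unfolding sp by (simp add: inner_diff_right uu)
    then show ?thesis by (auto simp: span_insert)
  qed
  then show "orthonormal_basis_of UNIV (insert u B)"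
    using B u uB unfolding orthonormal_basis_of_def
    by (auto simp: pairwise_insert orthogonal_def inner_commute)
qed

text \<open>
  The base point and the basis chosen in the definition of the measure on a hyperplane enter the later
  arguments only through this description.
\<close>

lemma nn_integral_affine_lborel_hyperplane:
  fixes u :: "'a::euclidean_space"
  assumes u: "norm u = 1"
  shows "\<exists>p B. u \<bullet> p = t \<and> orthonormal_basis_of {d. u \<bullet> d = 0} B \<and>
    (\<forall>S\<in>sets borel. emeasure (affine_lborel {x. u \<bullet> x = t}) S
        = (\<integral>\<^sup>+f. indicator S (p + (\<Sum>b\<in>B. f b *\<^sub>R b)) \<partial>(\<Pi>\<^sub>M b\<in>B. lborel)))"
proof -
  let ?H = "{x. u \<bullet> x = t}"
  define p where "p = (SOME p. p \<in> ?H)"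
  define B where "B = (SOME B. orthonormal_basis_of ((\<lambda>x. x - p) ` ?H) B)"
  have "t *\<^sub>R u \<in> ?H" using u by (simp add: norm_eq_1)
  then have p: "p \<in> ?H" unfolding p_def by (rule someI)
  have dir: "(\<lambda>x. x - p) ` ?H = {d. u \<bullet> d = 0}"
  proof (intro set_eqI iffI)
    fix d assume "d \<in> {d. u \<bullet> d = 0}"
    then have "d = (d + p) - p" "d + p \<in> ?H" using p by (auto simp: inner_add_right)
    then show "d \<in> (\<lambda>x. x - p) ` ?H" by blast
  qed (use p in \<open>auto simp: inner_diff_right\<close>)
  have "orthonormal_basis_of ((\<lambda>x. x - p) ` ?H) B"
    unfolding B_def by (rule someI_ex, rule orthonormal_basis_of_exists[OF affine_hyperplane p])
  then have B: "orthonormal_basis_of {d. u \<bullet> d = 0} B" by (simp only: dir)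
  have fin: "finite B"
    using orthonormal_basis_of_UNIV(1)[OF orthonormal_basis_insert_normal(1)[OF u B]] by simp
  show ?thesis
  proof (intro exI conjI ballI, rule p[simplified], rule B)
    fix S :: "'a set" assume [measurable]: "S \<in> sets borel"
    have "affine_lborel ?H = distr (\<Pi>\<^sub>M b\<in>B. lborel) borel (\<lambda>f. p + (\<Sum>b\<in>B. f b *\<^sub>R b))"
      unfolding affine_lborel_def Let_def p_def[symmetric] B_def[symmetric] ..
    then have "emeasure (affine_lborel ?H) S
       = (\<integral>\<^sup>+x. indicator S x \<partial>distr (\<Pi>\<^sub>M b\<in>B. lborel) borel (\<lambda>f. p + (\<Sum>b\<in>B. f b *\<^sub>R b)))"
      by simp
    also have "\<dots> = (\<integral>\<^sup>+f. indicator S (p + (\<Sum>b\<in>B. f b *\<^sub>R b)) \<partial>(\<Pi>\<^sub>M b\<in>B. lborel))"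
      using fin by (subst nn_integral_distr) auto
    finally show "emeasure (affine_lborel ?H) S = \<dots>" .
  qed
qed

text \<open>
  The prism over a subset \<open>S\<close> of the hyperplane \<open>u \<bullet> x = t\<close> with edge vector
  \<open>e\<close>: the points \<open>x + s *\<^sub>R e\<close> with \<open>x \<in> S\<close> and
  \<open>0 \<le> s \<le> 1\<close>. The equations recover \<open>s\<close> and \<open>x\<close> from the point, which
  makes measurability and the computation of slices immediate.
\<close>

definition oblique_prism :: "'a::euclidean_space \<Rightarrow> real \<Rightarrow> 'a \<Rightarrow> 'a set \<Rightarrow> 'a set" where
  "oblique_prism u t e S =
     {x. (u \<bullet> x - t) / (u \<bullet> e) \<in> {0..1} \<and> x - ((u \<bullet> x - t) / (u \<bullet> e)) *\<^sub>R e \<in> S}"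

lemma sets_oblique_prism [measurable]:
  assumes [measurable]: "S \<in> sets borel"
  shows "oblique_prism u t e S \<in> sets borel"
proof -
  have "oblique_prism u t e S =
     {x \<in> space borel. (u \<bullet> x - t) / (u \<bullet> e) \<in> {0..1} \<and> x - ((u \<bullet> x - t) / (u \<bullet> e)) *\<^sub>R e \<in> S}"
    by (simp add: oblique_prism_def)
  also have "\<dots> \<in> sets borel" by measurable
  finally show ?thesis .
qed

text \<open>
  Volume is base times height. Each slice of the prism parallel to the base is a translate of the base
  (Cavalieri), and \<open>\<bar>u \<bullet> e\<bar>\<close> is the height.
\<close>

lemma emeasure_oblique_prism:
  fixes u e :: "'a::euclidean_space"
  assumes u: "norm u = 1" and e: "u \<bullet> e \<noteq> 0" and S[measurable]: "S \<in> sets borel"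
  shows "emeasure lborel (oblique_prism u t e S)
    = ennreal \<bar>u \<bullet> e\<bar> * emeasure (affine_lborel {x. u \<bullet> x = t}) S"
proof -
  obtain p B where p: "u \<bullet> p = t" and B: "orthonormal_basis_of {d. u \<bullet> d = 0} B"
    and "\<forall>S\<in>sets borel. emeasure (affine_lborel {x. u \<bullet> x = t}) S
        = (\<integral>\<^sup>+f. indicator S (p + (\<Sum>b\<in>B. f b *\<^sub>R b)) \<partial>(\<Pi>\<^sub>M b\<in>B. lborel))"
    using nn_integral_affine_lborel_hyperplane[OF u, of t] by blast
  then have area: "emeasure (affine_lborel {x. u \<bullet> x = t}) S
        = (\<integral>\<^sup>+f. indicator S (p + (\<Sum>b\<in>B. f b *\<^sub>R b)) \<partial>(\<Pi>\<^sub>M b\<in>B. lborel))"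
    using S by blast
  note C = orthonormal_basis_insert_normal[OF u B]
  have fin: "finite B" using orthonormal_basis_of_UNIV(1)[OF C(1)] by simp
  have uu: "u \<bullet> u = 1" using u by (simp add: norm_eq_1)
  have uB: "u \<bullet> (\<Sum>b\<in>B. f b *\<^sub>R b) = 0" for f :: "'a \<Rightarrow> real"
  proof -
    have "(\<Sum>b\<in>B. f b *\<^sub>R b) \<in> span B" by (intro span_sum span_scale span_base)
    then show ?thesis using B by (simp add: orthonormal_basis_of_def)
  qed
  have expand: "(\<Sum>b\<in>B. (d \<bullet> b) *\<^sub>R b) = d" if "u \<bullet> d = 0" for d
    using orthonormal_basis_of_UNIV(3)[OF C(1), of d] C(2) fin that by (simp add: inner_commute)
  define \<alpha> where "\<alpha> = u \<bullet> e"
  let ?I = "\<integral>\<^sup>+f. indicator S (p + (\<Sum>b\<in>B. f b *\<^sub>R b)) \<partial>(\<Pi>\<^sub>M b\<in>B. lborel)"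
  have slice: "(\<integral>\<^sup>+f. indicator (oblique_prism u t e S) (p + (s *\<^sub>R u + (\<Sum>b\<in>B. f b *\<^sub>R b)))
            \<partial>(\<Pi>\<^sub>M b\<in>B. lborel)) = ?I * indicator {s. s / \<alpha> \<in> {0..1}} s" for s
  proof -
    \<comment> \<open>The displacement, within the hyperplane, of the slice at height s.\<close>
    define d where "d = s *\<^sub>R u - (s / \<alpha>) *\<^sub>R e"
    have ud: "u \<bullet> d = 0" using e by (simp add: d_def inner_diff_right uu \<alpha>_def)
    have mem: "indicator (oblique_prism u t e S) (p + (s *\<^sub>R u + (\<Sum>b\<in>B. f b *\<^sub>R b)))
       = (indicator S (p + (\<Sum>b\<in>B. (\<lambda>b\<in>B. d \<bullet> b + f b) b *\<^sub>R b)) * indicator {s. s / \<alpha> \<in> {0..1}} s :: ennreal)"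
      for f
    proof -
      have 1: "u \<bullet> (p + (s *\<^sub>R u + (\<Sum>b\<in>B. f b *\<^sub>R b))) - t = s"
        using p uB[of f] by (simp add: inner_add_right uu)
      have "(\<Sum>b\<in>B. (\<lambda>b\<in>B. d \<bullet> b + f b) b *\<^sub>R b) = (\<Sum>b\<in>B. (d \<bullet> b) *\<^sub>R b) + (\<Sum>b\<in>B. f b *\<^sub>R b)"
        by (simp add: scaleR_left_distrib sum.distrib)
      then have foot: "p + (s *\<^sub>R u + (\<Sum>b\<in>B. f b *\<^sub>R b)) - (s / \<alpha>) *\<^sub>R e
          = p + (\<Sum>b\<in>B. (\<lambda>b\<in>B. d \<bullet> b + f b) b *\<^sub>R b)"
        unfolding expand[OF ud] by (simp add: d_def)
      show ?thesis
        unfolding oblique_prism_def indicator_def mem_Collect_eq 1 \<alpha>_def[symmetric] foot by auto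
    qed
    have "(\<integral>\<^sup>+f. indicator S (p + (\<Sum>b\<in>B. (\<lambda>b\<in>B. d \<bullet> b + f b) b *\<^sub>R b)) \<partial>(\<Pi>\<^sub>M b\<in>B. lborel))
       = (\<integral>\<^sup>+f. indicator S (p + (\<Sum>b\<in>B. f b *\<^sub>R b))
           \<partial>distr (\<Pi>\<^sub>M b\<in>B. lborel) (\<Pi>\<^sub>M b\<in>B. lborel) (\<lambda>f. \<lambda>b\<in>B. d \<bullet> b + f b))"
      using fin by (subst nn_integral_distr) auto
    also have "\<dots> = ?I" by (simp only: distr_PiM_lborel_translation[OF fin])
    finally show ?thesis
      unfolding mem using fin by (subst nn_integral_multc) auto
  qed
  have interval: "emeasure lborel {s. s / \<alpha> \<in> {0..1}} = ennreal \<bar>\<alpha>\<bar>"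
  proof (cases "\<alpha> > 0")
    case True
    then have "{s. s / \<alpha> \<in> {0..1}} = {0..\<alpha>}" by (auto simp: divide_simps)
    then show ?thesis using True by simp
  next
    case False
    then have "\<alpha> < 0" using e by (simp add: \<alpha>_def)
    then have "{s. s / \<alpha> \<in> {0..1}} = {\<alpha>..0}" by (auto simp: divide_simps)
    then show ?thesis using \<open>\<alpha> < 0\<close> by simp
  qed
  have "emeasure lborel (oblique_prism u t e S) = (\<integral>\<^sup>+s. ?I * indicator {s. s / \<alpha> \<in> {0..1}} s \<partial>lborel)"
    using emeasure_lborel_slices(1)[OF C sets_oblique_prism[OF S], of u t e p] unfolding slice by simp
  also have "\<dots> = ?I * ennreal \<bar>\<alpha>\<bar>"
    by (subst nn_integral_cmult_indicator) (auto simp: interval[simplified])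
  finally show ?thesis by (simp only: area \<alpha>_def mult.commute)
qed

text \<open>
  The same volume, seen along the edges: the lines parallel to \<open>v\<close> meet the prism in segments of
  length one, so the volume is the area of the projection of \<open>S\<close> along \<open>v\<close>. Together
  with the preceding lemma this gives the ratio between the area of \<open>S\<close> and that of its
  projection.
\<close>

lemma emeasure_oblique_prism_projection:
  fixes u v :: "'a::euclidean_space"
  assumes C: "orthonormal_basis_of UNIV (insert v B)" "v \<notin> B" and v: "u \<bullet> v \<noteq> 0"
    and S[measurable]: "S \<in> sets borel"
  shows "emeasure lborel (oblique_prism u t v S)
    = (\<integral>\<^sup>+f. indicator S (((t - u \<bullet> (\<Sum>b\<in>B. f b *\<^sub>R b)) / (u \<bullet> v)) *\<^sub>R v + (\<Sum>b\<in>B. f b *\<^sub>R b))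
         \<partial>(\<Pi>\<^sub>M b\<in>B. lborel))"
proof -
  have slice: "(\<integral>\<^sup>+s. indicator (oblique_prism u t v S) (0 + (s *\<^sub>R v + y)) \<partial>lborel)
     = indicator S (((t - u \<bullet> y) / (u \<bullet> v)) *\<^sub>R v + y)" for y
  proof -
    define s0 where "s0 = (t - u \<bullet> y) / (u \<bullet> v)"
    have height: "(u \<bullet> (0 + (s *\<^sub>R v + y)) - t) / (u \<bullet> v) = s - s0" for s
      using v by (simp add: s0_def inner_add_right field_simps)
    have foot: "0 + (s *\<^sub>R v + y) - (s - s0) *\<^sub>R v = s0 *\<^sub>R v + y" for s
      by (simp add: algebra_simps)
    have "indicator (oblique_prism u t v S) (0 + (s *\<^sub>R v + y))
       = (indicator S (s0 *\<^sub>R v + y) * indicator {s0..s0 + 1} s :: ennreal)" for s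
      unfolding oblique_prism_def indicator_def mem_Collect_eq height foot by auto
    then show ?thesis
      by (simp add: nn_integral_cmult_indicator s0_def[symmetric])
  qed
  show ?thesis
    using emeasure_lborel_slices(2)[OF C sets_oblique_prism[OF S], of u t v 0] unfolding slice .
qed

section \<open>Sections of the cross-polytope\<close>

lemma orthonormal_basis_of_Basis: "orthonormal_basis_of UNIV (Basis :: 'a::euclidean_space set)"
  by (auto simp: orthonormal_basis_of_def pairwise_def orthogonal_def inner_Basis)

lemma closed_cross_polytope: "closed (cross_polytope :: (real ^ 'n) set)"
  unfolding cross_polytope_def by (intro closed_Collect_le continuous_intros)

lemma sum_abs_Basis:
  fixes x :: "real ^ 'n"
  shows "(\<Sum>i\<in>UNIV. \<bar>x $ i\<bar>) = (\<Sum>b\<in>Basis. \<bar>x \<bullet> b\<bar>)"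
proof -
  have Basis: "(Basis :: (real ^ 'n) set) = range (\<lambda>i. axis i 1)" by (auto simp: Basis_vec_def)
  have "inj (\<lambda>i::'n. axis i (1::real))" by (auto simp: inj_on_def axis_eq_axis)
  then show ?thesis unfolding Basis by (subst sum.reindex) (auto simp: inner_axis)
qed

text \<open>
  The projection along the \<open>k\<close>-th axis, with the \<open>k\<close>-th coordinate eliminated by means of
  the equation of the hyperplane.
\<close>

lemma emeasure_section_projection:
  fixes u :: "real ^ 'n" and k :: 'n
  defines "B \<equiv> Basis - {axis k 1}"
  assumes u: "norm u = 1" and k: "u $ k \<noteq> 0"
  shows "ennreal \<bar>u $ k\<bar> * emeasure (affine_lborel {x. u \<bullet> x = t}) (cross_polytope \<inter> {x. u \<bullet> x = t})
    = emeasure (\<Pi>\<^sub>M b\<in>B. lborel) {f \<in> space (\<Pi>\<^sub>M b\<in>B. lborel).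
        (\<Sum>b\<in>B. \<bar>f b\<bar>) + \<bar>(t - (\<Sum>b\<in>B. (u \<bullet> b) * f b)) / u $ k\<bar> \<le> 1}"
proof -
  let ?v = "axis k 1 :: real ^ 'n" and ?H = "{x. u \<bullet> x = t}"
  have vB: "insert ?v B = Basis" by (auto simp: B_def axis_in_Basis_iff)
  have fin: "finite B" by (simp add: B_def)
  have C: "orthonormal_basis_of UNIV (insert ?v B)" "?v \<notin> B"
    unfolding vB by (simp_all add: orthonormal_basis_of_Basis B_def)
  have uk: "u \<bullet> ?v = u $ k" by (simp add: inner_axis)
  have S: "cross_polytope \<inter> ?H \<in> sets borel"
    by (intro borel_closed closed_Int closed_cross_polytope closed_hyperplane)
  have mem: "((t - u \<bullet> y) / u $ k) *\<^sub>R ?v + y \<in> cross_polytope \<inter> ?H \<longleftrightarrow>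
      (\<Sum>b\<in>B. \<bar>f b\<bar>) + \<bar>(t - (\<Sum>b\<in>B. (u \<bullet> b) * f b)) / u $ k\<bar> \<le> 1"
    if y: "y = (\<Sum>b\<in>B. f b *\<^sub>R b)" for f y
  proof -
    define s0 where "s0 = (t - u \<bullet> y) / u $ k"
    have uy: "u \<bullet> y = (\<Sum>b\<in>B. (u \<bullet> b) * f b)"
      by (simp add: y inner_sum_right mult.commute)
    have xy: "s0 *\<^sub>R ?v + y = (\<Sum>b\<in>insert ?v B. (f(?v := s0)) b *\<^sub>R b)"
    proof -
      have "(\<Sum>b\<in>B. (f(?v := s0)) b *\<^sub>R b) = y" unfolding y using C(2) by (intro sum.cong) auto
      then show ?thesis using fin C(2) by simp
    qed
    have "(\<Sum>i\<in>UNIV. \<bar>(s0 *\<^sub>R ?v + y) $ i\<bar>) = (\<Sum>b\<in>insert ?v B. \<bar>(s0 *\<^sub>R ?v + y) \<bullet> b\<bar>)"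
      unfolding vB by (rule sum_abs_Basis)
    also have "\<dots> = (\<Sum>b\<in>insert ?v B. \<bar>(f(?v := s0)) b\<bar>)"
      unfolding xy using fin by (intro sum.cong refl, subst inner_orthonormal_sum[OF C(1)]) auto
    also have "\<dots> = \<bar>s0\<bar> + (\<Sum>b\<in>B. \<bar>f b\<bar>)"
    proof -
      have "(\<Sum>b\<in>B. \<bar>(f(?v := s0)) b\<bar>) = (\<Sum>b\<in>B. \<bar>f b\<bar>)" using C(2) by (intro sum.cong) auto
      then show ?thesis using fin C(2) by simp
    qed
    finally have norm1: "(\<Sum>i\<in>UNIV. \<bar>(s0 *\<^sub>R ?v + y) $ i\<bar>) = \<bar>s0\<bar> + (\<Sum>b\<in>B. \<bar>f b\<bar>)" .
    have "s0 *\<^sub>R ?v + y \<in> ?H" using k by (simp add: inner_add_right uk s0_def)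
    then show ?thesis
      unfolding s0_def[symmetric] cross_polytope_def uy[symmetric] using norm1 by (simp add: add.commute)
  qed
  have "ennreal \<bar>u $ k\<bar> * emeasure (affine_lborel ?H) (cross_polytope \<inter> ?H)
     = emeasure lborel (oblique_prism u t ?v (cross_polytope \<inter> ?H))"
    using emeasure_oblique_prism[OF u _ S, of ?v t] k by (simp add: uk)
  also have "\<dots> = (\<integral>\<^sup>+f. indicator {f \<in> space (\<Pi>\<^sub>M b\<in>B. lborel).
        (\<Sum>b\<in>B. \<bar>f b\<bar>) + \<bar>(t - (\<Sum>b\<in>B. (u \<bullet> b) * f b)) / u $ k\<bar> \<le> 1} f \<partial>(\<Pi>\<^sub>M b\<in>B. lborel))"
  proof (subst emeasure_oblique_prism_projection[OF C _ S], unfold uk, rule k, rule nn_integral_cong)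
    fix f assume "f \<in> space (\<Pi>\<^sub>M b\<in>B. (lborel :: real measure))"
    then show "indicator (cross_polytope \<inter> ?H)
        (((t - u \<bullet> (\<Sum>b\<in>B. f b *\<^sub>R b)) / u $ k) *\<^sub>R ?v + (\<Sum>b\<in>B. f b *\<^sub>R b)) =
      indicator {f \<in> space (\<Pi>\<^sub>M b\<in>B. lborel).
        (\<Sum>b\<in>B. \<bar>f b\<bar>) + \<bar>(t - (\<Sum>b\<in>B. (u \<bullet> b) * f b)) / u $ k\<bar> \<le> 1} f"
      unfolding indicator_def mem[OF refl] by simp
  qed
  also have "\<dots> = emeasure (\<Pi>\<^sub>M b\<in>B. lborel) {f \<in> space (\<Pi>\<^sub>M b\<in>B. lborel).
        (\<Sum>b\<in>B. \<bar>f b\<bar>) + \<bar>(t - (\<Sum>b\<in>B. (u \<bullet> b) * f b)) / u $ k\<bar> \<le> 1}"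
    using fin by (subst nn_integral_indicator) measurable
  finally show ?thesis .
qed

lemma card_Basis_minus:
  fixes k :: "'n::finite"
  shows "card (Basis - {axis k (1::real)}) = CARD('n) - 1"
  by (subst card_Diff_singleton) (auto simp: axis_in_Basis_iff)

text \<open>
  Dropping the absolute value around the eliminated coordinate encloses the projection of the section
  in a skew cross-polytope with \<open>r b = (u \<bullet> b) / a\<close>. (The enclosure is an equality, as
  the eliminated coordinate has constant sign on the section.) As \<open>u\<close> is a unit vector, the sum of
  the \<open>(r b)\<^sup>2\<close> is \<open>(1 - a\<^sup>2) / a\<^sup>2\<close>, and the product in the volume formula is
  estimated by the Weierstrass inequality, so that the bound depends on \<open>a\<close> and \<open>t\<close> only.
\<close>

lemma emeasure_section_le:
  fixes u :: "real ^ 'n" and k :: 'n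
  defines "m \<equiv> CARD('n) - 1" and "a \<equiv> \<bar>u $ k\<bar>"
  assumes u: "norm u = 1" and t: "1 / sqrt 2 < t" and a: "t \<le> a"
  shows "emeasure (affine_lborel {x. u \<bullet> x = t}) (cross_polytope \<inter> {x. u \<bullet> x = t})
    \<le> ennreal (2 ^ m / fact m * ((1 - t / a) ^ m * (a / (2 * a\<^sup>2 - 1))))"
proof -
  let ?E = "emeasure (affine_lborel {x. u \<bullet> x = t}) (cross_polytope \<inter> {x. u \<bullet> x = t})"
  define B where "B = Basis - {axis k 1 :: real ^ 'n}"
  define r where "r = (\<lambda>b. (u \<bullet> b) / a)"
  have fin: "finite B" and cardB: "card B = m"
    unfolding B_def m_def by (simp_all only: card_Basis_minus finite_Diff finite_Basis)
  have "1 / sqrt 2 < a" using t a by simp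
  then have a0: "0 < a" and a2: "0 < 2 * a\<^sup>2 - 1" using gt_inverse_sqrt_2 by auto
  have notin: "axis k 1 \<notin> B" by (simp add: B_def)
  have sumsq: "(\<Sum>b\<in>B. (r b)\<^sup>2) = (1 - a\<^sup>2) / a\<^sup>2"
  proof -
    have "(\<Sum>b\<in>insert (axis k 1) B. (u \<bullet> b)\<^sup>2) = u \<bullet> u"
    proof -
      have "insert (axis k 1) B = Basis" by (auto simp: B_def axis_in_Basis_iff)
      then show ?thesis
        by (simp only: euclidean_inner[of u u] power2_eq_square)
    qed
    then have "(\<Sum>b\<in>B. (u \<bullet> b)\<^sup>2) = 1 - a\<^sup>2"
      using fin u by (simp add: notin inner_axis a_def norm_eq_1)
    then show ?thesis by (simp add: r_def power_divide sum_divide_distrib[symmetric])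
  qed
  have sum_lt: "(\<Sum>b\<in>B. (r b)\<^sup>2) < 1" unfolding sumsq using a0 a2 by (simp add: divide_less_eq)
  have r2: "(r b)\<^sup>2 < 1" if "b \<in> B" for b
    using member_le_sum[OF that, of "\<lambda>b. (r b)\<^sup>2"] fin sum_lt by simp
  then have r1: "\<bar>r b\<bar> < 1" if "b \<in> B" for b using that by (simp add: abs_square_less_1)
  have w: "0 \<le> 1 - t / a" using a a0 by simp
  have prod: "(2 * a\<^sup>2 - 1) / a\<^sup>2 \<le> (\<Prod>b\<in>B. 1 - (r b)\<^sup>2)"
  proof -
    have "(2 * a\<^sup>2 - 1) / a\<^sup>2 = 1 - (\<Sum>b\<in>B. (r b)\<^sup>2)"
      unfolding sumsq using a0 by (simp add: field_simps)
    also have "\<dots> \<le> (\<Prod>b\<in>B. 1 - (r b)\<^sup>2)"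
      using fin r2 by (intro weierstrass_product_inequality) (auto intro: less_imp_le)
    finally show ?thesis .
  qed
  have pos: "0 < (2 * a\<^sup>2 - 1) / a\<^sup>2" using a0 a2 by simp
  have "ennreal a * ?E = emeasure (\<Pi>\<^sub>M b\<in>B. lborel) {f \<in> space (\<Pi>\<^sub>M b\<in>B. lborel).
        (\<Sum>b\<in>B. \<bar>f b\<bar>) + \<bar>(t - (\<Sum>b\<in>B. (u \<bullet> b) * f b)) / u $ k\<bar> \<le> 1}"
    unfolding a_def B_def using u a0 by (intro emeasure_section_projection) (auto simp: a_def)
  also have "\<dots> \<le> emeasure (\<Pi>\<^sub>M b\<in>B. lborel)
      {f \<in> space (\<Pi>\<^sub>M b\<in>B. lborel). (\<Sum>b\<in>B. \<bar>f b\<bar> - r b * f b) \<le> 1 - t / a}"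
  proof (rule emeasure_mono)
    have "(\<Sum>b\<in>B. \<bar>f b\<bar> - r b * f b) \<le> 1 - t / a"
      if "(\<Sum>b\<in>B. \<bar>f b\<bar>) + \<bar>(t - (\<Sum>b\<in>B. (u \<bullet> b) * f b)) / u $ k\<bar> \<le> 1" for f
    proof -
      have "(\<Sum>b\<in>B. \<bar>f b\<bar> - r b * f b) + t / a
          = (\<Sum>b\<in>B. \<bar>f b\<bar>) + (t - (\<Sum>b\<in>B. (u \<bullet> b) * f b)) / a"
        by (simp add: sum_subtractf r_def diff_divide_distrib sum_divide_distrib)
      also have "(t - (\<Sum>b\<in>B. (u \<bullet> b) * f b)) / a \<le> \<bar>(t - (\<Sum>b\<in>B. (u \<bullet> b) * f b)) / u $ k\<bar>"
        unfolding abs_divide a_def[symmetric] using a0 by (intro divide_right_mono) auto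
      finally show ?thesis using that by linarith
    qed
    then show "{f \<in> space (\<Pi>\<^sub>M b\<in>B. lborel).
        (\<Sum>b\<in>B. \<bar>f b\<bar>) + \<bar>(t - (\<Sum>b\<in>B. (u \<bullet> b) * f b)) / u $ k\<bar> \<le> 1}
      \<subseteq> {f \<in> space (\<Pi>\<^sub>M b\<in>B. lborel). (\<Sum>b\<in>B. \<bar>f b\<bar> - r b * f b) \<le> 1 - t / a}" by blast
    show "{f \<in> space (\<Pi>\<^sub>M b\<in>B. lborel). (\<Sum>b\<in>B. \<bar>f b\<bar> - r b * f b) \<le> 1 - t / a}
      \<in> sets (\<Pi>\<^sub>M b\<in>B. lborel)" using fin by measurable
  qed
  also have "\<dots> = ennreal ((1 - t / a) ^ m / fact m * (\<Prod>b\<in>B. 2 / (1 - (r b)\<^sup>2)))"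
    using emeasure_skew_cross_polytope[of B r, OF fin r1 w] by (simp only: cardB)
  also have "\<dots> \<le> ennreal (a * (2 ^ m / fact m * ((1 - t / a) ^ m * (a / (2 * a\<^sup>2 - 1)))))"
  proof (rule ennreal_leI)
    have "(\<Prod>b\<in>B. 2 / (1 - (r b)\<^sup>2)) = 2 ^ m / (\<Prod>b\<in>B. 1 - (r b)\<^sup>2)"
      by (simp add: prod_dividef cardB)
    also have "\<dots> \<le> 2 ^ m / ((2 * a\<^sup>2 - 1) / a\<^sup>2)"
      using prod pos by (intro divide_left_mono mult_pos_pos) auto
    finally have "(1 - t / a) ^ m / fact m * (\<Prod>b\<in>B. 2 / (1 - (r b)\<^sup>2))
       \<le> (1 - t / a) ^ m / fact m * (2 ^ m / ((2 * a\<^sup>2 - 1) / a\<^sup>2))"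
      using w by (intro mult_left_mono) auto
    also have "\<dots> = a * (2 ^ m / fact m * ((1 - t / a) ^ m * (a / (2 * a\<^sup>2 - 1))))"
      by (simp add: power2_eq_square)
    finally show "(1 - t / a) ^ m / fact m * (\<Prod>b\<in>B. 2 / (1 - (r b)\<^sup>2)) \<le> \<dots>" .
  qed
  also have "\<dots> = ennreal a * ennreal (2 ^ m / fact m * ((1 - t / a) ^ m * (a / (2 * a\<^sup>2 - 1))))"
    using a0 by (subst ennreal_mult') auto
  finally show ?thesis using a0
    by (subst (asm) ennreal_mult_le_mult_iff) auto
qed

text \<open>
  A linear functional attains its maximum over the cross-polytope at a vertex, where its value is one of
  the \<open>\<bar>u $ k\<bar>\<close>.
\<close>

lemma cross_polytope_section_empty:
  fixes u :: "real ^ 'n"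
  assumes "\<And>k. \<bar>u $ k\<bar> < t"
  shows "cross_polytope \<inter> {x. u \<bullet> x = t} = {}"
proof (rule ccontr)
  assume "\<not> ?thesis"
  then obtain x where x: "(\<Sum>i\<in>UNIV. \<bar>x $ i\<bar>) \<le> 1" "u \<bullet> x = t"
    by (auto simp: cross_polytope_def)
  define s where "s = Max (range (\<lambda>k. \<bar>u $ k\<bar>))"
  have st: "s < t" unfolding s_def using assms by (subst Max_less_iff) auto
  have us: "\<bar>u $ k\<bar> \<le> s" for k unfolding s_def by (intro Max_ge) auto
  then have s0: "0 \<le> s" using abs_ge_zero order_trans by blast
  have "t = (\<Sum>i\<in>UNIV. u $ i * x $ i)" using x(2) by (simp add: inner_vec_def)
  also have "\<dots> \<le> (\<Sum>i\<in>UNIV. s * \<bar>x $ i\<bar>)"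
  proof (intro sum_mono)
    fix i
    have "u $ i * x $ i \<le> \<bar>u $ i\<bar> * \<bar>x $ i\<bar>" by (metis abs_ge_self abs_mult)
    also have "\<dots> \<le> s * \<bar>x $ i\<bar>" using us by (intro mult_right_mono) auto
    finally show "u $ i * x $ i \<le> s * \<bar>x $ i\<bar>" .
  qed
  also have "\<dots> \<le> s * 1" unfolding sum_distrib_left[symmetric] using x(1) s0 by (rule mult_left_mono)
  finally show False using st by simp
qed

lemma norm_axis: "norm (axis k s :: real ^ 'n) = \<bar>s\<bar>"
  by (simp add: norm_eq_sqrt_inner inner_axis_axis)

text \<open>
  For a normal along an axis, the projection along this axis is a regular cross-polytope of radius
  \<open>1 - t\<close>.
\<close>

lemma section_volume_coordinate_hyperplane:
  fixes k :: "'n::finite"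
  defines "m \<equiv> CARD('n) - 1"
  assumes \<sigma>: "\<bar>\<sigma>\<bar> = 1" and t: "0 \<le> t" "t \<le> 1"
  shows "section_volume (cross_polytope :: (real ^ 'n) set) {x. axis k \<sigma> \<bullet> x = t}
    = 2 ^ m * (1 - t) ^ m / fact m"
proof -
  let ?u = "axis k \<sigma> :: real ^ 'n"
  define B where "B = Basis - {axis k 1 :: real ^ 'n}"
  have fin: "finite B" and cardB: "card B = m"
    unfolding B_def m_def by (simp_all only: card_Basis_minus finite_Diff finite_Basis)
  have u: "norm ?u = 1" using \<sigma> by (simp add: norm_axis)
  have uB: "?u \<bullet> b = 0" if "b \<in> B" for b
  proof -
    have "axis k 1 \<bullet> b = 0" using that by (auto simp: B_def inner_Basis axis_in_Basis_iff)
    moreover have "?u = \<sigma> *\<^sub>R axis k 1" by (simp add: vec_eq_iff axis_def)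
    ultimately show ?thesis by simp
  qed
  have "emeasure (affine_lborel {x. ?u \<bullet> x = t}) (cross_polytope \<inter> {x. ?u \<bullet> x = t})
     = ennreal \<bar>?u $ k\<bar> * emeasure (affine_lborel {x. ?u \<bullet> x = t}) (cross_polytope \<inter> {x. ?u \<bullet> x = t})"
    using \<sigma> by simp
  also have "\<dots> = emeasure (\<Pi>\<^sub>M b\<in>B. lborel) {f \<in> space (\<Pi>\<^sub>M b\<in>B. lborel).
        (\<Sum>b\<in>B. \<bar>f b\<bar>) + \<bar>(t - (\<Sum>b\<in>B. (?u \<bullet> b) * f b)) / ?u $ k\<bar> \<le> 1}"
    unfolding B_def using u \<sigma> by (intro emeasure_section_projection) auto
  also have "{f \<in> space (\<Pi>\<^sub>M b\<in>B. lborel).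
        (\<Sum>b\<in>B. \<bar>f b\<bar>) + \<bar>(t - (\<Sum>b\<in>B. (?u \<bullet> b) * f b)) / ?u $ k\<bar> \<le> 1}
     = {f \<in> space (\<Pi>\<^sub>M b\<in>B. lborel). (\<Sum>b\<in>B. \<bar>f b\<bar> - 0 * f b) \<le> 1 - t}"
    using \<sigma> t uB by (auto simp: abs_divide)
  also have "emeasure (\<Pi>\<^sub>M b\<in>B. lborel) \<dots> = ennreal ((1 - t) ^ m / fact m * 2 ^ m)"
    using emeasure_skew_cross_polytope[OF fin, of "\<lambda>_. 0" "1 - t"] t by (simp add: cardB)
  finally show ?thesis
    using t by (simp add: section_volume_def measure_def mult.commute)
qed

section \<open>Maximal sections far from the origin\<close>

lemma translate_coordinate_hyperplane:
  fixes d :: "real ^ 'n"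
  shows "(\<lambda>x. d + x) ` {x. x $ k = 0} = {x. x $ k = d $ k}"
proof (intro set_eqI iffI)
  fix x assume "x \<in> {x. x $ k = d $ k}"
  then have "x = d + (x - d)" "x - d \<in> {x. x $ k = 0}" by auto
  then show "x \<in> (\<lambda>x. d + x) ` {x. x $ k = 0}" by (rule image_eqI)
qed auto

theorem theorem4:
  fixes t :: real
  assumes "CARD('n::finite) \<ge> 3"
    and "1 / sqrt 2 < t" "t \<le> 1"
  defines "V \<equiv> 2 ^ (CARD('n) - 1) * (1 - t) ^ (CARD('n) - 1) / fact (CARD('n) - 1)"
  shows "(\<exists>H\<in>hyperplanes_at t. section_volume (cross_polytope :: (real ^ 'n) set) H = V)
       \<and> (\<forall>H\<in>hyperplanes_at t. section_volume (cross_polytope :: (real ^ 'n) set) H \<le> V)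
       \<and> (\<forall>H\<in>hyperplanes_at t. parallel_to_coordinate_hyperplane H \<longrightarrow>
            section_volume (cross_polytope :: (real ^ 'n) set) H = V)
       \<and> (t < 1 \<longrightarrow> (\<forall>H\<in>hyperplanes_at t.
            section_volume (cross_polytope :: (real ^ 'n) set) H = V \<longrightarrow>
              parallel_to_coordinate_hyperplane H))"
proof -
  define m where "m = CARD('n) - 1"
  have m: "2 \<le> m" using assms(1) by (simp add: m_def)
  have V: "V = 2 ^ m * (1 - t) ^ m / fact m" by (simp add: V_def m_def)
  have t0: "0 < t" using gt_inverse_sqrt_2[OF assms(2)] by simp
  have V0: "0 \<le> V" using assms(3) by (simp add: V)
  have coordinate: "section_volume cross_polytope {x :: real ^ 'n. axis k \<sigma> \<bullet> x = t} = V"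
    if "\<bar>\<sigma>\<bar> = 1" for k \<sigma>
    using section_volume_coordinate_hyperplane[of \<sigma> t k] that t0 assms(3) by (simp add: V m_def)
  have "{x :: real ^ 'n. axis k 1 \<bullet> x = t} \<in> hyperplanes_at t" for k
    unfolding hyperplanes_at_iff[OF t0] by (intro exI[of _ "axis k 1"]) (simp add: norm_axis)
  then have ex: "\<exists>H\<in>hyperplanes_at t. section_volume (cross_polytope :: (real ^ 'n) set) H = V"
    using coordinate[of 1] by fastforce
  have bound: "section_volume cross_polytope H \<le> V
      \<and> (section_volume cross_polytope H = V \<and> t < 1 \<longrightarrow> parallel_to_coordinate_hyperplane H)"
    if "H \<in> hyperplanes_at t" for H :: "(real ^ 'n) set"
  proof -
    obtain u where u: "norm u = 1" and H: "H = {x. u \<bullet> x = t}"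
      using \<open>H \<in> hyperplanes_at t\<close> unfolding hyperplanes_at_iff[OF t0] by blast
    consider (empty) "\<And>k. \<bar>u $ k\<bar> < t" | (axis) k where "\<bar>u $ k\<bar> = 1"
      | (cap) k where "t \<le> \<bar>u $ k\<bar>" "\<bar>u $ k\<bar> < 1"
      using component_le_norm_cart[of u] u by (metis leI order_le_less)
    then show ?thesis
    proof cases
      case empty
      then have "section_volume cross_polytope H = 0"
        unfolding section_volume_def H cross_polytope_section_empty[OF empty] by simp
      moreover have "0 < V" if "t < 1" using that by (simp add: V)
      ultimately show ?thesis using V0 by fastforce
    next
      case axis
      have u_eq: "u = axis k (u $ k)"
      proof -
        have "(\<Sum>i\<in>UNIV. (u $ i)\<^sup>2) = 1"
          using u by (simp add: norm_eq_1 inner_vec_def power2_eq_square)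
        moreover have sq1: "(u $ k)\<^sup>2 = 1" using axis by (metis power2_abs one_power2)
        ultimately have "(\<Sum>i\<in>UNIV - {k}. (u $ i)\<^sup>2) = 0"
          using sq1 by (simp add: sum.remove[of UNIV k])
        then have "u $ i = 0" if "i \<noteq> k" for i
          using that by (subst (asm) sum_nonneg_eq_0_iff) auto
        then show ?thesis by (auto simp: vec_eq_iff axis_def)
      qed
      then have vol: "section_volume cross_polytope H = V"
        unfolding H using coordinate[OF axis, of k] by metis
      have "affine_parallel {x :: real ^ 'n. x $ k = 0} H"
      proof -
        have "u \<bullet> x = u $ k * x $ k" for x
          by (subst u_eq) (simp add: inner_axis' mult.commute)
        moreover have sq: "u $ k * u $ k = 1" using axis by (metis abs_mult_self_eq mult_1)
        ultimately have "H = {x. x $ k = t * u $ k}"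
          unfolding H using axis
          by (auto simp: abs_if split: if_splits)
        then have "H = (\<lambda>x. axis k (t * u $ k) + x) ` {x. x $ k = 0}"
          by (simp only: translate_coordinate_hyperplane) simp
        then show ?thesis unfolding affine_parallel_def by blast
      qed
      then have "affine_parallel H {x. x $ k = 0}" by (rule affine_parallel_commute)
      then show ?thesis using vol by (auto simp: parallel_to_coordinate_hyperplane_def)
    next
      case cap
      let ?a = "\<bar>u $ k\<bar>"
      let ?U = "2 ^ m / fact m * ((1 - t / ?a) ^ m * (?a / (2 * ?a\<^sup>2 - 1)))"
      have U0: "0 \<le> ?U"
      proof -
        have "0 < 2 * ?a\<^sup>2 - 1" using assms(2) cap by (intro gt_inverse_sqrt_2) simp
        moreover have "0 \<le> 1 - t / ?a" using cap t0 by simp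
        ultimately show ?thesis by simp
      qed
      have "section_volume cross_polytope H \<le> enn2real (ennreal ?U)"
        unfolding section_volume_def measure_def H m_def
        by (intro enn2real_mono emeasure_section_le[OF u assms(2) cap(1)]) simp
      also have "\<dots> = ?U" using U0 by simp
      also have "\<dots> < 2 ^ m / fact m * (1 - t) ^ m"
        using cap_inequality[OF assms(2) cap m] by (intro mult_strict_left_mono) auto
      also have "\<dots> = V" by (simp add: V)
      finally show ?thesis by auto
    qed
  qed
  have par: "section_volume cross_polytope H = V"
    if dist: "H \<in> hyperplanes_at t" and parallel: "parallel_to_coordinate_hyperplane H" for H :: "(real ^ 'n) set"
  proof -
    obtain k where "affine_parallel {x :: real ^ 'n. x $ k = 0} H"
      using parallel affine_parallel_commute unfolding parallel_to_coordinate_hyperplane_def by blast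
    then obtain d where "H = (\<lambda>x. d + x) ` {x. x $ k = 0}" by (auto simp: affine_parallel_def)
    then have H: "H = {x. x $ k = d $ k}" by (simp only: translate_coordinate_hyperplane)
    then have "H = {x. axis k 1 \<bullet> x = d $ k}" by (simp add: inner_axis')
    then have "infdist 0 H = \<bar>d $ k\<bar>"
      using infdist_hyperplane[of "axis k 1 :: real ^ 'n" "d $ k"] by (simp add: norm_axis axis_eq_0_iff)
    then have d: "\<bar>d $ k\<bar> = t" using dist by (simp add: hyperplanes_at_def)
    then have "H = {x. axis k (sgn (d $ k)) \<bullet> x = t}"
      unfolding H using t0 by (auto simp: inner_axis' sgn_if split: if_splits)
    then show ?thesis using coordinate[of "sgn (d $ k)" k] d t0 by (auto simp: abs_sgn_eq)
  qed
  show ?thesis using ex bound par by blast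
qed

end
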